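(* Let $\mathcal H$ be a real Hilbert space, $f,g,h$ proper closed convex functions on $\mathcal H$ with $h$ differentiable and $\nabla h$ $(1/\beta)$-Lipschitz, $\beta>0$. Set $A=\partial f$, $B=\partial g$, $C=\nabla h$. Let $\varepsilon\in(0,1)$, $\gamma\in(0,2\beta\varepsilon)$, $\alpha=1/(2-\varepsilon)$, $(\lambda_j)_{j\ge0}\subseteq(0,1/\alpha]$. Let $T:=I_{\mathcal H}-J_{\gamma B}+J_{\gamma A}\circ(2J_{\gamma B}-I_{\mathcal H}-\gamma C\circ J_{\gamma B})$ have a fixed point $z^\ast$, and let $x^\ast=J_{\gamma B}(z^\ast)$, $u_B^\ast=\gamma^{-1}(z^\ast-x^\ast)$. Let $z^0\in\mathcal H$, $z^{k+1}=(1-\lambda_k)z^k+\lambda_kTz^k$, $x_g^k:=J_{\gamma B}(z^k)$, $x_f^k:=J_{\gamma A}(2x_g^k-z^k-\gamma\nabla h(x_g^k))$, and $$\overline x_f^k=\frac1{\sum_{i=0}^k\lambda_i}\sum_{i=0}^k\lambda_ix_f^i,\qquad\overline x_g^k=\frac1{\sum_{i=0}^k\lambda_i}\sum_{i=0}^k\lambda_ix_g^i.$$ Then: 1. For all $k\ge0$, $$\frac{-2\|z^0-z^\ast\|\,\|u_B^\ast+Cx^\ast\|}{\sum_{i=0}^k\lambda_i}\le f(\overline x_f^k)+g(\overline x_g^k)+h(\overline x_g^k)-(f+g+h)(x^\ast)\le\frac{\|z^0-x^\ast\|^2+\frac{\gamma}{2\beta\varepsilon-\gamma}\|z^0-z^\ast\|^2+4\gamma\|z^0-z^\ast\|\,\|Cx^\ast\|}{2\gamma\sum_{i=0}^k\lambda_i}.$$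 2. Suppose $f$ is $L$-Lipschitz continuous on the closed ball of center $x^\ast$ and radius $(1+\gamma/\beta)\|z^0-z^\ast\|$. Then for all $k\ge0$ $$0\le f(\overline x_g^k)+g(\overline x_g^k)+h(\overline x_g^k)-(f+g+h)(x^\ast)\le\frac{\|z^0-x^\ast\|^2+\frac{\gamma}{2\beta\varepsilon-\gamma}\|z^0-z^\ast\|^2+4\gamma\|z^0-z^\ast\|\,\|Cx^\ast\|+4\gamma L\|z^0-z^\ast\|}{2\gamma\sum_{i=0}^k\lambda_i}.$$
   Context: $J_S:=(I_{\mathcal H}+S)^{-1}$ is the resolvent of a maximal monotone operator $S$; $\partial$ is the convex subdifferential. *)

theory Defs
  imports "HOL-Analysis.Analysis"
begin

text \<open>
  A convex function on a real Hilbert space is modelled as a map into \<^typ>\<open>ereal\<close>, and a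
  Hilbert space by the sort \<open>{real_inner, complete_space}\<close>.
\<close>

definition epi :: "('a \<Rightarrow> ereal) \<Rightarrow> ('a \<times> real) set" where
  "epi f = {(x, t). f x \<le> ereal t}"

definition proper_fun :: "('a \<Rightarrow> ereal) \<Rightarrow> bool" where
  "proper_fun f \<longleftrightarrow> (\<forall>x. f x \<noteq> -\<infinity>) \<and> (\<exists>x. f x \<noteq> \<infinity>)"

definition proper_closed_convex :: "('a::real_normed_vector \<Rightarrow> ereal) \<Rightarrow> bool" where
  "proper_closed_convex f \<longleftrightarrow> proper_fun f \<and> closed (epi f) \<and> convex (epi f)"

text \<open>
  For proper \<open>f\<close> the subdifferential is empty wherever \<open>f\<close> is infinite: a point where \<open>f\<close> is
  finite refutes the inequality.
\<close>

definition subdifferential :: "('a::real_inner \<Rightarrow> ereal) \<Rightarrow> 'a \<Rightarrow> 'a set" where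
  "subdifferential f x = {u. \<forall>y. f y \<ge> f x + ereal (u \<bullet> (y - x))}"

definition scale_op :: "real \<Rightarrow> ('a \<Rightarrow> 'a::real_vector set) \<Rightarrow> 'a \<Rightarrow> 'a set" where
  "scale_op c S x = (\<lambda>u. c *\<^sub>R u) ` S x"

text \<open>
  The resolvent \<open>(I + S)\<^sup>-\<^sup>1\<close> of a set-valued operator \<open>S\<close>. It is single-valued and defined everywhere
  when \<open>S\<close> is maximal monotone; outside that case the description need not denote.
\<close>

definition resolvent :: "('a \<Rightarrow> 'a::real_vector set) \<Rightarrow> 'a \<Rightarrow> 'a" where
  "resolvent S x = (THE y. x \<in> {y + u | u. u \<in> S y})"

text \<open>
  Lipschitz continuity on \<open>S\<close> of an extended-valued function includes its finiteness on \<open>S\<close>;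
  \<^const>\<open>real_of_ereal\<close> alone would send infinite values to 0.
\<close>

definition ereal_lipschitz_on :: "real \<Rightarrow> 'a::metric_space set \<Rightarrow> ('a \<Rightarrow> ereal) \<Rightarrow> bool" where
  "ereal_lipschitz_on L S f \<longleftrightarrow>
     (\<forall>x\<in>S. \<bar>f x\<bar> \<noteq> \<infinity>) \<and> L-lipschitz_on S (\<lambda>x. real_of_ereal (f x))"

end

theory Submission
  imports Defs
begin

text \<open>
  With \<open>u\<^sub>B = (z - x\<^sub>g)/\<gamma> \<in> \<partial>g(x\<^sub>g)\<close>, \<open>u\<^sub>A = (2x\<^sub>g - z - \<gamma> C x\<^sub>g - x\<^sub>f)/\<gamma> \<in> \<partial>f(x\<^sub>f)\<close> and \<open>w = x\<^sub>f - x\<^sub>g = T z - z\<close> one has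
  \<open>2\<gamma>(u\<^sub>A \<bullet> (x\<^sub>f - x) + (u\<^sub>B + C x\<^sub>g) \<bullet> (x\<^sub>g - x)) = 2(x - z) \<bullet> w - 2\<gamma> C x\<^sub>g \<bullet> w - 2\<parallel>w\<parallel>\<^sup>2\<close>.
  Applied to differences with the fixed point, monotonicity and cocoercivity of \<open>C\<close> (Baillon--Haddad)
  turn it into Fejer monotonicity of \<open>z\<^sup>k\<close> together with
  \<open>\<Sum> \<lambda>\<^sub>k \<parallel>C x\<^sub>g\<^sup>k - C x\<^sup>*\<parallel>\<^sup>2 \<le> \<epsilon> \<parallel>z\<^sup>0 - z\<^sup>*\<parallel>\<^sup>2 / (\<gamma>(2\<beta>\<epsilon> - \<gamma>))\<close>. Applied with \<open>x = x\<^sup>*\<close> it bounds the objective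
  gap by a telescoping sum, and Jensen's inequality passes to the averages. The lower bounds are the
  subgradient inequalities at \<open>x\<^sup>*\<close>, using that \<open>\<Sum> \<lambda>\<^sub>i w\<^sub>i = z\<^sup>k\<^sup>+\<^sup>1 - z\<^sup>0\<close> has norm at most \<open>2\<parallel>z\<^sup>0 - z\<^sup>*\<parallel>\<close>.
\<close>

section \<open>Proximal points and resolvents of subdifferentials\<close>

text \<open>
  Replaces the affine minorant that Hahn--Banach would give: near a point of the domain \<open>f\<close> is
  bounded below by closedness of the epigraph, and convexity along rays propagates this bound
  linearly.
\<close>

lemma epi_lower_bound:
  fixes f :: "'a::real_normed_vector \<Rightarrow> ereal"
  assumes f: "proper_closed_convex f"
  obtains x0 s K where "K \<ge> 0" "\<And>y t. (y, t) \<in> epi f \<Longrightarrow> s - K * norm (y - x0) \<le> t"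
proof -
  have cl: "closed (epi f)" and cv: "convex (epi f)" and pr: "proper_fun f"
    using f by (auto simp: proper_closed_convex_def)
  obtain x0 where x0: "f x0 \<noteq> \<infinity>" "f x0 \<noteq> -\<infinity>"
    using pr by (auto simp: proper_fun_def)
  then obtain t0 where t0: "f x0 = ereal t0" by (cases "f x0") auto
  \<comment> \<open>Chosen strictly below the graph at \<open>x0\<close>, so a whole ball around
    \<open>(x0, s)\<close> misses the closed epigraph.\<close>
  define s where "s = t0 - 1"
  have in0: "(x0, t0) \<in> epi f" by (simp add: epi_def t0)
  have "(x0, s) \<in> - epi f" by (simp add: epi_def t0 s_def)
  then obtain r where r: "r > 0" "ball (x0, s) r \<subseteq> - epi f"
    using cl by (metis open_Compl open_contains_ball)
  have near: "s < t" if yt: "(y, t) \<in> epi f" "norm (y - x0) < r" for y t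
  proof (rule ccontr)
    assume "\<not> s < t"
    then have "(y, s) \<in> epi f" using yt(1) by (auto simp: epi_def intro: order_trans)
    moreover have "(y, s) \<in> ball (x0, s) r"
      using yt(2) by (simp add: dist_Pair_Pair dist_norm norm_minus_commute)
    ultimately show False using r(2) by auto
  qed
  have "s - 2 / r * norm (y - x0) \<le> t" if yt: "(y, t) \<in> epi f" for y t
  proof (cases "norm (y - x0) < r")
    case True
    have "0 \<le> 2 / r * norm (y - x0)" using r(1) by simp
    then show ?thesis using near[OF yt True] by linarith
  next
    case False
    define d where "d = norm (y - x0)"
    \<comment> \<open>With this weight the convex combination lies at distance exactly
      \<open>r / 2\<close> from \<open>x0\<close>, hence where \<open>near\<close> applies.\<close>
    define \<tau> where "\<tau> = r / (2 * d)"
    have d: "d \<ge> r" "d > 0" using False r(1) by (auto simp: d_def)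
    have \<tau>: "0 < \<tau>" "\<tau> \<le> 1" using d r(1) by (auto simp: \<tau>_def field_simps)
    have "(1 - \<tau>) *\<^sub>R (x0, t0) + \<tau> *\<^sub>R (y, t) \<in> epi f"
      using cv in0 yt \<tau> by (intro convexD) auto
    then have "((1 - \<tau>) *\<^sub>R x0 + \<tau> *\<^sub>R y, (1 - \<tau>) * t0 + \<tau> * t) \<in> epi f" by simp
    moreover have "norm ((1 - \<tau>) *\<^sub>R x0 + \<tau> *\<^sub>R y - x0) < r"
    proof -
      have "(1 - \<tau>) *\<^sub>R x0 + \<tau> *\<^sub>R y - x0 = \<tau> *\<^sub>R (y - x0)" by (simp add: algebra_simps)
      then have "norm ((1 - \<tau>) *\<^sub>R x0 + \<tau> *\<^sub>R y - x0) = \<tau> * d" using \<tau> by (simp add: d_def)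
      also have "\<dots> = r / 2" using d by (simp add: \<tau>_def)
      finally show ?thesis using r(1) by simp
    qed
    ultimately have "s < (1 - \<tau>) * t0 + \<tau> * t" using near by blast
    then have "\<tau> * (t0 - t) < 1" by (simp add: s_def algebra_simps)
    then have "t0 - t < 1 / \<tau>" using \<tau> by (simp add: field_simps)
    then have "t0 - 1 / \<tau> < t" by linarith
    moreover have "1 / \<tau> = 2 / r * d" by (simp add: \<tau>_def)
    ultimately show ?thesis by (simp add: s_def d_def)
  qed
  then show thesis using that[of "2 / r" s x0] r(1) by simp
qed

text \<open>
  Minimizing sequences are Cauchy by the parallelogram identity applied to midpoints, so no weak
  compactness is needed.
\<close>

lemma prox_minimizer:
  fixes E :: "('a::{real_inner, complete_space} \<times> real) set"
  assumes cl: "closed E" and cv: "convex E" and ne: "E \<noteq> {}" and \<gamma>: "\<gamma> > 0"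
    and lb: "\<And>y t. (y, t) \<in> E \<Longrightarrow> b \<le> t + (norm (y - x))\<^sup>2 / (2 * \<gamma>)"
  obtains p q where "(p, q) \<in> E"
    "\<And>y t. (y, t) \<in> E \<Longrightarrow> q + (norm (p - x))\<^sup>2 / (2 * \<gamma>) \<le> t + (norm (y - x))\<^sup>2 / (2 * \<gamma>)"
proof -
  define \<phi> where "\<phi> = (\<lambda>(y, t). t + (norm (y - x))\<^sup>2 / (2 * \<gamma>))"
  define m where "m = Inf (\<phi> ` E)"
  have bdd: "bdd_below (\<phi> ` E)"
    using lb by (intro bdd_belowI[of _ b]) (auto simp: \<phi>_def)
  have m: "m \<le> \<phi> e" if "e \<in> E" for e
    unfolding m_def using that bdd by (intro cInf_lower) auto
  have "\<exists>e\<in>E. \<phi> e < m + inverse (real (Suc n))" for n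
  proof -
    have "Inf (\<phi> ` E) < m + inverse (real (Suc n))" by (simp add: m_def)
    then show ?thesis using ne bdd by (subst (asm) cInf_less_iff) auto
  qed
  then obtain e where e: "\<And>n. e n \<in> E" "\<And>n. \<phi> (e n) < m + inverse (real (Suc n))"
    by metis
  define y where "y n = fst (e n)" for n
  have \<phi>_lim: "(\<lambda>n. \<phi> (e n)) \<longlonglongrightarrow> m"
  proof (rule tendsto_sandwich[of "\<lambda>_. m" _ _ "\<lambda>n. m + inverse (real (Suc n))"])
    show "(\<lambda>n. m + inverse (real (Suc n))) \<longlonglongrightarrow> m"
      using tendsto_add[OF tendsto_const[of m] LIMSEQ_inverse_real_of_nat] by simp
  qed (use m e(1) e(2)[THEN less_imp_le] in simp_all)
  have mid: "(norm (y i - y j))\<^sup>2 \<le> 4 * \<gamma> * (\<phi> (e i) - m + (\<phi> (e j) - m))" for i j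
  proof -
    have "(1/2) *\<^sub>R e i + (1/2) *\<^sub>R e j \<in> E" by (rule convexD[OF cv e(1) e(1)]) simp_all
    then have "m \<le> \<phi> ((1/2) *\<^sub>R e i + (1/2) *\<^sub>R e j)" by (rule m)
    also have "\<dots> = (\<phi> (e i) + \<phi> (e j)) / 2 - (norm (y i - y j))\<^sup>2 / (8 * \<gamma>)"
    proof -
      have "(norm ((1/2) *\<^sub>R y i + (1/2) *\<^sub>R y j - x))\<^sup>2
          = ((norm (y i - x))\<^sup>2 + (norm (y j - x))\<^sup>2) / 2 - (norm (y i - y j))\<^sup>2 / 4"
        unfolding power2_norm_eq_inner
        by (simp add: inner_diff_left inner_diff_right inner_add_left inner_add_right inner_commute)
          (simp add: field_simps)
      then show ?thesis
        by (simp add: \<phi>_def case_prod_beta y_def add_divide_distrib diff_divide_distrib)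
    qed
    finally show ?thesis using \<gamma> by (simp add: field_simps)
  qed
  have "Cauchy y"
  proof (rule metric_CauchyI)
    fix r :: real assume r: "r > 0"
    \<comment> \<open>Two errors below \<open>\<delta>\<close> make the right-hand side of
      \<open>mid\<close> smaller than
      \<open>4 * \<gamma> * (2 * \<delta>) = r\<^sup>2\<close>.\<close>
    define \<delta> where "\<delta> = r\<^sup>2 / (8 * \<gamma>)"
    have "\<delta> > 0" using r \<gamma> by (simp add: \<delta>_def)
    then have "\<forall>\<^sub>F n in sequentially. \<phi> (e n) < m + \<delta>"
      using \<phi>_lim by (intro order_tendstoD(2)) auto
    then obtain M where M: "\<And>n. n \<ge> M \<Longrightarrow> \<phi> (e n) < m + \<delta>"
      by (auto simp: eventually_sequentially)
    have "dist (y i) (y j) < r" if "i \<ge> M" "j \<ge> M" for i j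
    proof -
      have "\<phi> (e i) - m + (\<phi> (e j) - m) < 2 * \<delta>" using M[OF that(1)] M[OF that(2)] by linarith
      then have "4 * \<gamma> * (\<phi> (e i) - m + (\<phi> (e j) - m)) < 4 * \<gamma> * (2 * \<delta>)"
        using \<gamma> by simp
      also have "\<dots> = r\<^sup>2" using \<gamma> by (simp add: \<delta>_def)
      finally have "(norm (y i - y j))\<^sup>2 < r\<^sup>2" using mid[of i j] by linarith
      then show ?thesis using r by (simp add: dist_norm power_less_imp_less_base)
    qed
    then show "\<exists>M. \<forall>i\<ge>M. \<forall>j\<ge>M. dist (y i) (y j) < r" by blast
  qed
  then obtain p where p: "y \<longlonglongrightarrow> p" using Cauchy_convergent convergent_def by blast
  \<comment> \<open>The forced limit of the heights, since \<open>\<phi> (e n)\<close> tends to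
    \<open>m\<close> and \<open>y n\<close> to \<open>p\<close>. Closedness of \<open>E\<close> then
    puts the pair \<open>(p, q)\<close> itself in \<open>E\<close>.\<close>
  define q where "q = m - (norm (p - x))\<^sup>2 / (2 * \<gamma>)"
  have "(\<lambda>n. \<phi> (e n) - (norm (y n - x))\<^sup>2 / (2 * \<gamma>)) \<longlonglongrightarrow> q"
    unfolding q_def using \<gamma> by (intro tendsto_intros \<phi>_lim p) auto
  moreover have "snd (e n) = \<phi> (e n) - (norm (y n - x))\<^sup>2 / (2 * \<gamma>)" for n
    by (simp add: \<phi>_def y_def case_prod_beta)
  ultimately have "(\<lambda>n. snd (e n)) \<longlonglongrightarrow> q" by simp
  then have "(\<lambda>n. (y n, snd (e n))) \<longlonglongrightarrow> (p, q)" by (intro tendsto_Pair p)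
  then have "e \<longlonglongrightarrow> (p, q)" by (simp add: y_def)
  then have "(p, q) \<in> E" using cl e(1) by (metis closed_sequentially)
  moreover have "q + (norm (p - x))\<^sup>2 / (2 * \<gamma>) \<le> t + (norm (u - x))\<^sup>2 / (2 * \<gamma>)"
    if "(u, t) \<in> E" for u t
    using m[OF that] by (simp add: q_def \<phi>_def)
  ultimately show thesis using that by blast
qed

text \<open>The quadratic term dominates the at most linear decrease of \<open>f\<close>, so
  \<open>prox_minimizer\<close> applies to the epigraph. The subgradient is the first-order
  optimality condition: the minimizer is compared with the point moved by a fraction
  \<open>\<theta>\<close> towards \<open>(y, t)\<close>, and \<open>\<theta>\<close> tends to
  0.\<close>

lemma prox_exists:
  fixes f :: "'a::{real_inner, complete_space} \<Rightarrow> ereal"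
  assumes f: "proper_closed_convex f" and \<gamma>: "\<gamma> > 0"
  shows "\<exists>p. (1 / \<gamma>) *\<^sub>R (x - p) \<in> subdifferential f p"
proof -
  have cl: "closed (epi f)" and cv: "convex (epi f)" and pr: "proper_fun f"
    using f by (auto simp: proper_closed_convex_def)
  obtain x0 s K where K: "K \<ge> 0" and lb: "\<And>y t. (y, t) \<in> epi f \<Longrightarrow> s - K * norm (y - x0) \<le> t"
    by (rule epi_lower_bound[OF f]) blast
  have bound: "s - K * norm (x - x0) - \<gamma> * K\<^sup>2 / 2 \<le> t + (norm (y - x))\<^sup>2 / (2 * \<gamma>)"
    if yt: "(y, t) \<in> epi f" for y t
  proof -
    have "K * norm (y - x0) \<le> K * (norm (y - x) + norm (x - x0))"
      using norm_triangle_ineq[of "y - x" "x - x0"] K by (intro mult_left_mono) simp_all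
    then have "K * norm (y - x0) \<le> K * norm (y - x) + K * norm (x - x0)"
      by (simp add: distrib_left)
    \<comment> \<open>Completing the square produces the constant
      \<open>\<gamma> * K\<^sup>2 / 2\<close> of \<open>bound\<close>.\<close>
    moreover have "K * norm (y - x) \<le> \<gamma> * K\<^sup>2 / 2 + (norm (y - x))\<^sup>2 / (2 * \<gamma>)"
    proof -
      have "0 \<le> (\<gamma> * K - norm (y - x))\<^sup>2 / (2 * \<gamma>)" using \<gamma> by simp
      also have "\<dots> = \<gamma> * K\<^sup>2 / 2 + (norm (y - x))\<^sup>2 / (2 * \<gamma>) - K * norm (y - x)"
        using \<gamma> by (simp add: power2_eq_square) (simp add: field_simps)
      finally show ?thesis by simp
    qed
    ultimately show ?thesis using lb[OF yt] by linarith
  qed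
  obtain x1 where "f x1 \<noteq> \<infinity>" using pr by (auto simp: proper_fun_def)
  have ne: "epi f \<noteq> {}" 
  proof -
    have "(x1, real_of_ereal (f x1)) \<in> epi f"
      using pr \<open>f x1 \<noteq> \<infinity>\<close> by (auto simp: epi_def proper_fun_def ereal_real)
    then show ?thesis by blast
  qed
  obtain p q where pq: "(p, q) \<in> epi f"
    and min: "\<And>y t. (y, t) \<in> epi f \<Longrightarrow>
      q + (norm (p - x))\<^sup>2 / (2 * \<gamma>) \<le> t + (norm (y - x))\<^sup>2 / (2 * \<gamma>)"
    by (rule prox_minimizer[OF cl cv ne \<gamma> bound]) blast+
  have sub: "q + (x - p) \<bullet> (y - p) / \<gamma> \<le> t" if yt: "(y, t) \<in> epi f" for y t
  proof -
    \<comment> \<open>Minimality along the segment, divided by \<open>\<theta>\<close>: the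
      second-order remainder keeps one factor \<open>\<theta>\<close> and vanishes in the
      limit.\<close>
    have step: "q + (x - p) \<bullet> (y - p) / \<gamma> - \<theta> * ((norm (y - p))\<^sup>2 / (2 * \<gamma>)) \<le> t"
      if \<theta>: "0 < \<theta>" "\<theta> < 1" for \<theta>
    proof -
      have "(1 - \<theta>) *\<^sub>R (p, q) + \<theta> *\<^sub>R (y, t) \<in> epi f"
        using \<theta> by (intro convexD[OF cv pq yt]) simp_all
      then have "((1 - \<theta>) *\<^sub>R p + \<theta> *\<^sub>R y, (1 - \<theta>) * q + \<theta> * t) \<in> epi f" by simp
      from min[OF this] have "q + (norm (p - x))\<^sup>2 / (2 * \<gamma>)
        \<le> (1 - \<theta>) * q + \<theta> * t + (norm ((1 - \<theta>) *\<^sub>R p + \<theta> *\<^sub>R y - x))\<^sup>2 / (2 * \<gamma>)" .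
      moreover have "(norm ((1 - \<theta>) *\<^sub>R p + \<theta> *\<^sub>R y - x))\<^sup>2 / (2 * \<gamma>)
        = (norm (p - x))\<^sup>2 / (2 * \<gamma>) - \<theta> * ((x - p) \<bullet> (y - p) / \<gamma>)
          + \<theta> * (\<theta> * ((norm (y - p))\<^sup>2 / (2 * \<gamma>)))"
      proof -
        have "(1 - \<theta>) *\<^sub>R p + \<theta> *\<^sub>R y - x = (p - x) + \<theta> *\<^sub>R (y - p)"
          by (simp add: algebra_simps)
        then have "(norm ((1 - \<theta>) *\<^sub>R p + \<theta> *\<^sub>R y - x))\<^sup>2
          = (norm (p - x))\<^sup>2 - 2 * \<theta> * ((x - p) \<bullet> (y - p)) + \<theta>\<^sup>2 * (norm (y - p))\<^sup>2"
          unfolding power2_norm_eq_inner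
          by (simp add: inner_diff_left inner_diff_right inner_add_left inner_add_right inner_commute
              power2_eq_square algebra_simps)
        then show ?thesis by (simp add: diff_divide_distrib add_divide_distrib power2_eq_square)
      qed
      ultimately have "0 \<le> \<theta> * (t - q - (x - p) \<bullet> (y - p) / \<gamma> + \<theta> * ((norm (y - p))\<^sup>2 / (2 * \<gamma>)))"
        by (simp add: algebra_simps)
      then have "0 \<le> t - q - (x - p) \<bullet> (y - p) / \<gamma> + \<theta> * ((norm (y - p))\<^sup>2 / (2 * \<gamma>))"
        using \<theta> by (simp add: zero_le_mult_iff)
      then show ?thesis by linarith
    qed
    have "((\<lambda>\<theta>. q + (x - p) \<bullet> (y - p) / \<gamma> - \<theta> * ((norm (y - p))\<^sup>2 / (2 * \<gamma>)))
        \<longlongrightarrow> q + (x - p) \<bullet> (y - p) / \<gamma> - 0 * ((norm (y - p))\<^sup>2 / (2 * \<gamma>))) (at_right 0)"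
      by (intro tendsto_intros)
    moreover have "\<forall>\<^sub>F \<theta> in at_right 0.
        q + (x - p) \<bullet> (y - p) / \<gamma> - \<theta> * ((norm (y - p))\<^sup>2 / (2 * \<gamma>)) \<le> t"
      unfolding eventually_at_right_field using step by (intro exI[of _ 1]) auto
    ultimately have "q + (x - p) \<bullet> (y - p) / \<gamma> - 0 * ((norm (y - p))\<^sup>2 / (2 * \<gamma>)) \<le> t"
      by (rule tendsto_upperbound) simp
    then show ?thesis by simp
  qed
  have "f p \<le> ereal q" using pq by (simp add: epi_def)
  have "f y \<ge> f p + ereal (((1 / \<gamma>) *\<^sub>R (x - p)) \<bullet> (y - p))" for y
  proof (cases "f y")
    case (real t)
    then have "q + (x - p) \<bullet> (y - p) / \<gamma> \<le> t" by (intro sub) (simp add: epi_def)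
    then have "ereal q + ereal (((1 / \<gamma>) *\<^sub>R (x - p)) \<bullet> (y - p)) \<le> f y"
      using real by simp
    then show ?thesis using \<open>f p \<le> ereal q\<close> by (meson add_right_mono order_trans)
  qed (use pr in \<open>auto simp: proper_fun_def\<close>)
  then show ?thesis by (auto simp: subdifferential_def)
qed

lemma subdifferential_finite:
  assumes "proper_fun f" "u \<in> subdifferential f p"
  shows "\<bar>f p\<bar> \<noteq> \<infinity>"
proof -
  obtain y where "f y \<noteq> \<infinity>" using assms(1) by (auto simp: proper_fun_def)
  moreover have "f p + ereal (u \<bullet> (y - p)) \<le> f y" using assms(2) by (auto simp: subdifferential_def)
  ultimately have "f p \<noteq> \<infinity>" by auto
  then show ?thesis using assms(1) by (auto simp: proper_fun_def)
qed

lemma subgradient_real: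
  assumes "proper_fun f" "u \<in> subdifferential f p" "\<bar>f y\<bar> \<noteq> \<infinity>"
  shows "real_of_ereal (f p) + u \<bullet> (y - p) \<le> real_of_ereal (f y)"
proof -
  have "f p + ereal (u \<bullet> (y - p)) \<le> f y" using assms(2) by (auto simp: subdifferential_def)
  then show ?thesis using subdifferential_finite[OF assms(1,2)] assms(3)
    by (cases "f p"; cases "f y") auto
qed

lemma subdifferential_monotone:
  assumes "proper_fun f" "u \<in> subdifferential f p" "v \<in> subdifferential f q"
  shows "0 \<le> (u - v) \<bullet> (p - q)"
  using subgradient_real[OF assms(1,2) subdifferential_finite[OF assms(1,3)]]
    subgradient_real[OF assms(1,3) subdifferential_finite[OF assms(1,2)]]
  by (simp add: inner_simps)

text \<open>Shows that the definite description in \<open>resolvent\<close> denotes: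
  \<open>prox_exists\<close> gives a solution and monotonicity makes it unique.\<close>

lemma resolvent_subdifferential:
  fixes f :: "'a::{real_inner, complete_space} \<Rightarrow> ereal"
  assumes f: "proper_closed_convex f" and \<gamma>: "\<gamma> > 0"
  shows "(1 / \<gamma>) *\<^sub>R (x - resolvent (scale_op \<gamma> (subdifferential f)) x)
    \<in> subdifferential f (resolvent (scale_op \<gamma> (subdifferential f)) x)"
proof -
  let ?P = "\<lambda>p. (1 / \<gamma>) *\<^sub>R (x - p) \<in> subdifferential f p"
  have pr: "proper_fun f" using f by (simp add: proper_closed_convex_def)
  have iff: "x \<in> {p + u | u. u \<in> scale_op \<gamma> (subdifferential f) p} \<longleftrightarrow> ?P p" for p
  proof
    assume "x \<in> {p + u | u. u \<in> scale_op \<gamma> (subdifferential f) p}"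
    then show "?P p" using \<gamma> by (auto simp: scale_op_def)
  next
    assume "?P p"
    moreover have "x = p + \<gamma> *\<^sub>R ((1 / \<gamma>) *\<^sub>R (x - p))" using \<gamma> by simp
    ultimately show "x \<in> {p + u | u. u \<in> scale_op \<gamma> (subdifferential f) p}"
      unfolding scale_op_def by blast
  qed
  have unique: "p = q" if "?P p" "?P q" for p q
  proof -
    have "0 \<le> ((1 / \<gamma>) *\<^sub>R (x - p) - (1 / \<gamma>) *\<^sub>R (x - q)) \<bullet> (p - q)"
      by (rule subdifferential_monotone[OF pr that])
    also have "\<dots> = - (1 / \<gamma>) * (norm (p - q))\<^sup>2"
      unfolding power2_norm_eq_inner by (simp add: inner_simps algebra_simps diff_divide_distrib)
    finally have "(norm (p - q))\<^sup>2 \<le> 0" using \<gamma> by (simp add: divide_le_0_iff)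
    then show ?thesis by simp
  qed
  have "\<exists>!p. ?P p" using prox_exists[OF f \<gamma>, of x] unique by blast
  then have "?P (THE p. ?P p)" by (rule theI')
  then show ?thesis unfolding resolvent_def iff .
qed

section \<open>Jensen's inequality and smooth convex functions\<close>

text \<open>Finite values turn the graph points into points of the convex epigraph. The bound is
  stated in \<open>ereal\<close> because finiteness at the mean is not yet known; it will be deduced
  from this bound.\<close>

lemma jensen_epi:
  fixes f :: "'a::real_normed_vector \<Rightarrow> ereal"
  assumes cv: "convex (epi f)" and fin: "finite I" and w: "\<And>i. i \<in> I \<Longrightarrow> w i \<ge> 0"
    and pos: "sum w I > 0" and finite_val: "\<And>i. i \<in> I \<Longrightarrow> \<bar>f (x i)\<bar> \<noteq> \<infinity>"
  shows "f ((1 / sum w I) *\<^sub>R (\<Sum>i\<in>I. w i *\<^sub>R x i))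
    \<le> ereal ((\<Sum>i\<in>I. w i * real_of_ereal (f (x i))) / sum w I)"
proof -
  have "(\<Sum>i\<in>I. (w i / sum w I) *\<^sub>R (x i, real_of_ereal (f (x i)))) \<in> epi f"
  proof (rule convex_sum[OF fin cv])
    show "(\<Sum>i\<in>I. w i / sum w I) = 1" using pos by (simp flip: sum_divide_distrib)
    show "(x i, real_of_ereal (f (x i))) \<in> epi f" if "i \<in> I" for i
      using finite_val[OF that] by (simp add: epi_def ereal_real)
  qed (use w pos in auto)
  moreover have "(\<Sum>i\<in>I. (w i / sum w I) *\<^sub>R (x i, real_of_ereal (f (x i))))
    = ((1 / sum w I) *\<^sub>R (\<Sum>i\<in>I. w i *\<^sub>R x i), (\<Sum>i\<in>I. w i * real_of_ereal (f (x i))) / sum w I)"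
    by (simp add: prod_eq_iff fst_sum snd_sum scaleR_sum_right sum_divide_distrib)
  ultimately show ?thesis by (simp add: epi_def)
qed

lemma has_real_derivative_along_line:
  assumes "\<And>x. GDERIV h x :> C x"
  shows "((\<lambda>t. h (x + t *\<^sub>R d)) has_real_derivative C (x + t *\<^sub>R d) \<bullet> d) (at t)"
proof -
  have "(h has_derivative (\<lambda>v. v \<bullet> C (x + t *\<^sub>R d))) (at (x + t *\<^sub>R d))"
    using assms by (simp add: gderiv_def)
  moreover have "((\<lambda>t. x + t *\<^sub>R d) has_derivative (\<lambda>s. s *\<^sub>R d)) (at t)"
    by (auto intro!: derivative_eq_intros)
  ultimately have "((\<lambda>t. h (x + t *\<^sub>R d)) has_derivative (\<lambda>s. (s *\<^sub>R d) \<bullet> C (x + t *\<^sub>R d))) (at t)"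
    using has_derivative_compose by fastforce
  moreover have "(\<lambda>s. (s *\<^sub>R d) \<bullet> C (x + t *\<^sub>R d)) = (*) (C (x + t *\<^sub>R d) \<bullet> d)"
    by (auto simp: inner_commute)
  ultimately show ?thesis by (simp add: has_field_derivative_def)
qed

text \<open>Restriction to the line through \<open>x\<close> and \<open>y\<close> reduces this to
  the tangent inequality for a convex function of one real variable.\<close>

lemma convex_gradient_inequality:
  assumes cv: "convex (epi (\<lambda>x. ereal (h x)))" and grad: "\<And>x. GDERIV h x :> C x"
  shows "h x + C x \<bullet> (y - x) \<le> h y"
proof -
  let ?\<phi> = "\<lambda>t. h (x + t *\<^sub>R (y - x))"
  have "convex_on UNIV ?\<phi>"
  proof (rule convex_onI)
    fix t a b :: real assume t: "0 < t" "t < 1"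
    have "(1 - t) *\<^sub>R (x + a *\<^sub>R (y - x), ?\<phi> a) + t *\<^sub>R (x + b *\<^sub>R (y - x), ?\<phi> b)
        \<in> epi (\<lambda>x. ereal (h x))"
      using t by (intro convexD[OF cv]) (auto simp: epi_def)
    moreover have "(1 - t) *\<^sub>R (x + a *\<^sub>R (y - x)) + t *\<^sub>R (x + b *\<^sub>R (y - x))
        = x + ((1 - t) *\<^sub>R a + t *\<^sub>R b) *\<^sub>R (y - x)"
      by (simp add: algebra_simps)
    ultimately show "?\<phi> ((1 - t) *\<^sub>R a + t *\<^sub>R b) \<le> (1 - t) * ?\<phi> a + t * ?\<phi> b"
      by (simp add: epi_def)
  qed simp
  then have "C (x + 0 *\<^sub>R (y - x)) \<bullet> (y - x) * (1 - 0) \<le> ?\<phi> 1 - ?\<phi> 0"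
    using has_real_derivative_along_line[of h C x "y - x" 0, OF grad]
    by (intro convex_on_imp_above_tangent[of UNIV]) auto
  then show ?thesis by simp
qed

text \<open>By Cauchy-Schwarz and the Lipschitz bound, \<open>?\<psi>\<close> has nonpositive
  derivative on the unit interval; comparing its end values replaces integrating the
  gradient.\<close>

lemma descent_lemma:
  assumes grad: "\<And>x. GDERIV h x :> C x" and lip: "L-lipschitz_on UNIV C"
  shows "h y \<le> h x + C x \<bullet> (y - x) + L / 2 * (norm (y - x))\<^sup>2"
proof -
  define d where "d = y - x"
  let ?\<psi> = "\<lambda>t. h (x + t *\<^sub>R d) - t * (C x \<bullet> d) - L / 2 * t\<^sup>2 * (norm d)\<^sup>2"
  have "?\<psi> 1 \<le> ?\<psi> 0"
  proof (rule DERIV_nonpos_imp_nonincreasing[of 0 1 ?\<psi>])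
    fix t :: real assume t: "0 \<le> t" "t \<le> 1"
    have "(?\<psi> has_real_derivative C (x + t *\<^sub>R d) \<bullet> d - C x \<bullet> d - L * t * (norm d)\<^sup>2) (at t)"
      by (auto intro!: derivative_eq_intros has_real_derivative_along_line[OF grad])
    moreover have "(C (x + t *\<^sub>R d) - C x) \<bullet> d \<le> L * t * (norm d)\<^sup>2"
    proof -
      have "(C (x + t *\<^sub>R d) - C x) \<bullet> d \<le> norm (C (x + t *\<^sub>R d) - C x) * norm d"
        by (rule norm_cauchy_schwarz)
      also have "norm (C (x + t *\<^sub>R d) - C x) \<le> L * norm (t *\<^sub>R d)"
        using lipschitz_onD[OF lip, of "x + t *\<^sub>R d" x] by (simp add: dist_norm)
      finally show ?thesis using t by (simp add: power2_eq_square mult_right_mono mult.assoc)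
    qed
    ultimately show "\<exists>D. (?\<psi> has_real_derivative D) (at t) \<and> D \<le> 0"
      by (intro exI conjI) (auto simp: inner_simps)
  qed simp
  then show ?thesis by (simp add: d_def)
qed

text \<open>The tangent inequality at \<open>x\<close> and the descent lemma at \<open>y\<close>,
  both evaluated at an auxiliary point, sharpen convexity by a squared gradient difference. Adding
  the copy with \<open>x\<close> and \<open>y\<close> exchanged cancels the values of
  \<open>h\<close>.\<close>

lemma baillon_haddad:
  assumes cv: "convex (epi (\<lambda>x. ereal (h x)))" and grad: "\<And>x. GDERIV h x :> C x"
    and \<beta>: "\<beta> > 0" and lip: "(1 / \<beta>)-lipschitz_on UNIV C"
  shows "\<beta> * (norm (C x - C y))\<^sup>2 \<le> (C x - C y) \<bullet> (x - y)"
proof -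
  have *: "h x + C x \<bullet> (y - x) + \<beta> / 2 * (norm (C y - C x))\<^sup>2 \<le> h y" for x y
  proof -
    \<comment> \<open>\<open>w\<close> minimizes the quadratic majorant of \<open>h - C x \<bullet> _\<close> at \<open>y\<close>.\<close>
    define w where "w = y - \<beta> *\<^sub>R (C y - C x)"
    have "h x + C x \<bullet> (w - x) \<le> h w" by (rule convex_gradient_inequality[OF cv grad])
    also have "h w \<le> h y + C y \<bullet> (w - y) + 1 / \<beta> / 2 * (norm (w - y))\<^sup>2"
      by (rule descent_lemma[OF grad lip])
    finally have "h x + C x \<bullet> (w - x) \<le> h y + C y \<bullet> (w - y) + 1 / \<beta> / 2 * (norm (w - y))\<^sup>2" .
    moreover have "1 / \<beta> / 2 * (norm (w - y))\<^sup>2 = \<beta> / 2 * (norm (C y - C x))\<^sup>2"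
    proof -
      have "w - y = - (\<beta> *\<^sub>R (C y - C x))" by (simp add: w_def)
      then have "norm (w - y) = \<beta> * norm (C y - C x)"
        using \<beta> by (simp only: norm_minus_cancel norm_scaleR)
      then show ?thesis using \<beta> by (simp add: power2_eq_square)
    qed
    moreover have "C x \<bullet> (w - x) - C y \<bullet> (w - y) = C x \<bullet> (y - x) + \<beta> * (norm (C y - C x))\<^sup>2"
      unfolding power2_norm_eq_inner w_def by (simp add: inner_simps inner_commute algebra_simps)
    ultimately show ?thesis by simp
  qed
  show ?thesis using *[of x y] *[of y x]
    by (simp add: inner_simps norm_minus_commute)
qed

section \<open>One-step estimates for the splitting iteration\<close>

text \<open>
  Here \<open>y = x\<^sub>g\<close>, \<open>w = x\<^sub>f - x\<^sub>g = T z - z\<close> and \<open>c = C x\<^sub>g\<close>; the identity is also applied to differences of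
  such data with those of the fixed point.
\<close>

lemma splitting_identity:
  fixes z y w c x :: "'a::real_inner"
  assumes uB: "\<gamma> *\<^sub>R uB = z - y" and uA: "\<gamma> *\<^sub>R uA = y - z - \<gamma> *\<^sub>R c - w"
  shows "2 * \<gamma> * (uA \<bullet> (y + w - x) + (uB + c) \<bullet> (y - x))
    = 2 * ((x - z) \<bullet> w) - 2 * \<gamma> * (c \<bullet> w) - 2 * (norm w)\<^sup>2"
proof -
  have "\<gamma> * (uA \<bullet> (y + w - x) + (uB + c) \<bullet> (y - x))
      = (\<gamma> *\<^sub>R uA) \<bullet> (y + w - x) + (\<gamma> *\<^sub>R uB + \<gamma> *\<^sub>R c) \<bullet> (y - x)"
    by (simp add: inner_add_left algebra_simps)
  also have "\<dots> = (x - z) \<bullet> w - \<gamma> * (c \<bullet> w) - (norm w)\<^sup>2"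
    unfolding uA uB power2_norm_eq_inner
    by (simp add: inner_diff_left inner_diff_right inner_add_left inner_add_right inner_commute algebra_simps)
  finally show ?thesis by simp
qed

text \<open>An expanded square. Its weight spends only \<open>\<epsilon>\<close> of the
  \<open>2 * (norm w)\<^sup>2\<close> supplied by \<open>splitting_identity\<close>, leaving
  \<open>2 - \<epsilon>\<close> to pay for the relaxation.\<close>

lemma inner_young:
  fixes d w :: "'a::real_inner"
  assumes "\<epsilon> > 0"
  shows "- 2 * \<gamma> * (d \<bullet> w) \<le> \<epsilon> * (norm w)\<^sup>2 + \<gamma>\<^sup>2 / \<epsilon> * (norm d)\<^sup>2"
proof -
  have "0 \<le> (norm (\<epsilon> *\<^sub>R w + \<gamma> *\<^sub>R d))\<^sup>2 / \<epsilon>" using assms by simp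
  also have "(norm (\<epsilon> *\<^sub>R w + \<gamma> *\<^sub>R d))\<^sup>2
      = \<epsilon>\<^sup>2 * (norm w)\<^sup>2 + 2 * \<epsilon> * \<gamma> * (d \<bullet> w) + \<gamma>\<^sup>2 * (norm d)\<^sup>2"
    unfolding power2_norm_eq_inner
    by (simp add: inner_add_left inner_add_right inner_commute power2_eq_square algebra_simps)
  also have "\<dots> / \<epsilon> = \<epsilon> * (norm w)\<^sup>2 + 2 * \<gamma> * (d \<bullet> w) + \<gamma>\<^sup>2 / \<epsilon> * (norm d)\<^sup>2"
    using assms by (simp add: add_divide_distrib power2_eq_square)
  finally show ?thesis by simp
qed

lemma norm_relaxed_step:
  fixes z w x :: "'a::real_inner"
  shows "(norm (z + l *\<^sub>R w - x))\<^sup>2 = (norm (z - x))\<^sup>2 - 2 * l * ((x - z) \<bullet> w) + l\<^sup>2 * (norm w)\<^sup>2"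
  unfolding power2_norm_eq_inner
  by (simp add: inner_diff_left inner_diff_right inner_add_left inner_add_right inner_commute
      power2_eq_square algebra_simps)

text \<open>Cocoercivity contributes \<open>2 * \<gamma> * \<beta>\<close> times the squared
  gradient difference and Young's inequality takes back \<open>\<gamma>\<^sup>2 / \<epsilon>\<close>
  of it; the difference of the two is the coefficient in the conclusion.\<close>

lemma fejer_step:
  fixes z zs y xs w c cs :: "'a::real_inner"
  assumes uB: "\<gamma> *\<^sub>R uB = z - y" and uA: "\<gamma> *\<^sub>R uA = y - z - \<gamma> *\<^sub>R c - w"
    and uBs: "\<gamma> *\<^sub>R uBs = zs - xs" and uAs: "\<gamma> *\<^sub>R uAs = xs - zs - \<gamma> *\<^sub>R cs"
    and monA: "0 \<le> (uA - uAs) \<bullet> (y + w - xs)" and monB: "0 \<le> (uB - uBs) \<bullet> (y - xs)"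
    and coco: "\<beta> * (norm (c - cs))\<^sup>2 \<le> (c - cs) \<bullet> (y - xs)"
    and pos: "\<gamma> > 0" "\<epsilon> > 0" and l: "0 \<le> l" "l \<le> 2 - \<epsilon>"
  shows "(norm (z + l *\<^sub>R w - zs))\<^sup>2 + l * (\<gamma> * (2 * \<beta> * \<epsilon> - \<gamma>) / \<epsilon>) * (norm (c - cs))\<^sup>2
    \<le> (norm (z - zs))\<^sup>2"
proof -
  define N where "N = (norm (c - cs))\<^sup>2"
  have "2 * \<gamma> * (\<beta> * N)
      \<le> 2 * \<gamma> * ((uA - uAs) \<bullet> ((y - xs) + w - 0) + ((uB - uBs) + (c - cs)) \<bullet> ((y - xs) - 0))"
    using monA monB coco pos
    by (intro mult_left_mono) (simp_all add: inner_add_left algebra_simps N_def)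
  \<comment> \<open>Every vector is replaced by its difference from the fixed-point data. The fixed
    point has zero displacement, so \<open>w\<close> itself remains.\<close>
  also have "\<dots> = 2 * ((0 - (z - zs)) \<bullet> w) - 2 * \<gamma> * ((c - cs) \<bullet> w) - 2 * (norm w)\<^sup>2"
    by (rule splitting_identity) (simp_all add: scaleR_diff_right uA uB uAs uBs)
  also have "\<dots> \<le> 2 * ((zs - z) \<bullet> w) - (2 - \<epsilon>) * (norm w)\<^sup>2 + \<gamma>\<^sup>2 / \<epsilon> * N"
    using inner_young[OF pos(2), of \<gamma> "c - cs" w] by (simp add: algebra_simps N_def)
  finally have *: "\<gamma> * (2 * \<beta> * \<epsilon> - \<gamma>) / \<epsilon> * N \<le> 2 * ((zs - z) \<bullet> w) - (2 - \<epsilon>) * (norm w)\<^sup>2"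
    using pos by (simp add: field_simps power2_eq_square)
  have "l * (\<gamma> * (2 * \<beta> * \<epsilon> - \<gamma>) / \<epsilon>) * N \<le> l * (2 * ((zs - z) \<bullet> w) - (2 - \<epsilon>) * (norm w)\<^sup>2)"
    using mult_left_mono[OF * l(1)] by (simp add: mult.assoc)
  also have "\<dots> \<le> 2 * l * ((zs - z) \<bullet> w) - l\<^sup>2 * (norm w)\<^sup>2"
  proof -
    \<comment> \<open>The relaxation bound enters here; in the theorem \<open>2 - \<epsilon>\<close>
      is \<open>1 / \<alpha>\<close>.\<close>
    have "0 \<le> l * (2 - \<epsilon> - l) * (norm w)\<^sup>2" using l by simp
    then show ?thesis by (simp add: algebra_simps power2_eq_square)
  qed
  finally show ?thesis unfolding norm_relaxed_step N_def by simp
qed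

text \<open>Here the identity is applied to the step itself, with \<open>xs\<close> as base point.
  In \<open>c = (c - cs) + cs\<close> the first part is absorbed by Young's inequality, while the
  second stays linear in \<open>l *\<^sub>R w\<close> and telescopes under summation.\<close>

lemma upper_step:
  fixes z y xs w c cs :: "'a::real_inner"
  assumes uB: "\<gamma> *\<^sub>R uB = z - y" and uA: "\<gamma> *\<^sub>R uA = y - z - \<gamma> *\<^sub>R c - w"
    and pos: "\<epsilon> > 0" and l: "0 \<le> l" "l \<le> 2 - \<epsilon>"
  shows "2 * \<gamma> * l * (uA \<bullet> (y + w - xs) + (uB + c) \<bullet> (y - xs))
    \<le> (norm (z - xs))\<^sup>2 - (norm (z + l *\<^sub>R w - xs))\<^sup>2
      + \<gamma>\<^sup>2 / \<epsilon> * (l * (norm (c - cs))\<^sup>2) - 2 * \<gamma> * (cs \<bullet> (l *\<^sub>R w))"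
proof -
  have "2 * \<gamma> * (uA \<bullet> (y + w - xs) + (uB + c) \<bullet> (y - xs))
      = 2 * ((xs - z) \<bullet> w) - 2 * \<gamma> * (c \<bullet> w) - 2 * (norm w)\<^sup>2"
    by (rule splitting_identity[OF uB uA])
  also have "\<dots> \<le> 2 * ((xs - z) \<bullet> w) - l * (norm w)\<^sup>2 + \<gamma>\<^sup>2 / \<epsilon> * (norm (c - cs))\<^sup>2 - 2 * \<gamma> * (cs \<bullet> w)"
  proof -
    have "(\<epsilon> + l) * (norm w)\<^sup>2 \<le> 2 * (norm w)\<^sup>2" using l by (intro mult_right_mono) auto
    then show ?thesis using inner_young[OF pos, of \<gamma> "c - cs" w]
      by (simp add: inner_diff_left algebra_simps)
  qed
  finally have "l * (2 * \<gamma> * (uA \<bullet> (y + w - xs) + (uB + c) \<bullet> (y - xs)))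
      \<le> l * (2 * ((xs - z) \<bullet> w) - l * (norm w)\<^sup>2 + \<gamma>\<^sup>2 / \<epsilon> * (norm (c - cs))\<^sup>2 - 2 * \<gamma> * (cs \<bullet> w))"
    using l(1) by (rule mult_left_mono)
  then show ?thesis unfolding norm_relaxed_step by (simp add: algebra_simps power2_eq_square)
qed

text \<open>Monotonicity gives firm nonexpansiveness
  \<open>(norm e)\<^sup>2 \<le> d \<bullet> e\<close>, and the second bound, for the reflected
  resolvent, follows by expanding a square. Both serve to locate the iterates in the ball where
  \<open>f\<close> is Lipschitz.\<close>

lemma resolvent_step_nonexpansive:
  fixes x y :: "'a::real_inner"
  assumes mon: "0 \<le> ((1 / \<gamma>) *\<^sub>R (x - p) - (1 / \<gamma>) *\<^sub>R (y - q)) \<bullet> (p - q)" and \<gamma>: "\<gamma> > 0"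
  shows "norm (p - q) \<le> norm (x - y)"
    and "norm ((2 *\<^sub>R p - x) - (2 *\<^sub>R q - y)) \<le> norm (x - y)"
proof -
  define d e where "d = x - y" and "e = p - q"
  have "(1 / \<gamma>) *\<^sub>R (x - p) - (1 / \<gamma>) *\<^sub>R (y - q) = (1 / \<gamma>) *\<^sub>R (d - e)"
    by (simp add: d_def e_def algebra_simps)
  then have firm: "(norm e)\<^sup>2 \<le> d \<bullet> e"
    using mon \<gamma> unfolding power2_norm_eq_inner
    by (simp add: e_def[symmetric] inner_diff_left zero_le_divide_iff)
  have "norm e * norm e \<le> norm d * norm e"
    using firm norm_cauchy_schwarz[of d e] by (simp add: power2_eq_square)
  then show "norm (p - q) \<le> norm (x - y)"
    by (cases "e = 0") (auto simp: d_def e_def)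
  have "(norm (2 *\<^sub>R e - d))\<^sup>2 = (norm d)\<^sup>2 - 4 * (d \<bullet> e - (norm e)\<^sup>2)"
    unfolding power2_norm_eq_inner
    by (simp add: inner_diff_left inner_diff_right inner_commute algebra_simps)
  then have "(norm (2 *\<^sub>R e - d))\<^sup>2 \<le> (norm d)\<^sup>2" using firm by simp
  then have "norm (2 *\<^sub>R e - d) \<le> norm d" by (rule power2_le_imp_le) simp
  moreover have "2 *\<^sub>R e - d = (2 *\<^sub>R p - x) - (2 *\<^sub>R q - y)"
    by (simp add: d_def e_def algebra_simps)
  ultimately show "norm ((2 *\<^sub>R p - x) - (2 *\<^sub>R q - y)) \<le> norm (x - y)" unfolding d_def by metis
qed

lemma weighted_mean_in_cball:
  fixes x :: "'i \<Rightarrow> 'a::real_normed_vector"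
  assumes "finite I" "\<And>i. i \<in> I \<Longrightarrow> w i \<ge> 0" "sum w I > 0" "\<And>i. i \<in> I \<Longrightarrow> x i \<in> cball a r"
  shows "(1 / sum w I) *\<^sub>R (\<Sum>i\<in>I. w i *\<^sub>R x i) \<in> cball a r"
proof -
  have "(\<Sum>i\<in>I. (w i / sum w I) *\<^sub>R x i) \<in> cball a r"
    using assms by (intro convex_sum) (auto simp flip: sum_divide_distrib)
  then show ?thesis by (simp add: scaleR_sum_right)
qed

section \<open>Ergodic convergence rates\<close>

theorem corollaryD5:
  fixes f g :: "'a::{real_inner, complete_space} \<Rightarrow> ereal"
    and h :: "'a \<Rightarrow> real"
    and A B :: "'a \<Rightarrow> 'a set"
    and C T JA JB :: "'a \<Rightarrow> 'a"
    and \<beta> \<epsilon> \<gamma> \<alpha> :: real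
    and lam :: "nat \<Rightarrow> real"
    and zs xs uBs :: 'a
    and z xf xg xf_avg xg_avg :: "nat \<Rightarrow> 'a"
  assumes f: "proper_closed_convex f"
    and g: "proper_closed_convex g"
    and h: "proper_closed_convex (\<lambda>x. ereal (h x))"
    and \<beta>: "\<beta> > 0"
    and grad_h: "\<And>x. GDERIV h x :> C x"
    and C_lipschitz: "(1 / \<beta>)-lipschitz_on UNIV C"
    and A: "A = subdifferential f"
    and B: "B = subdifferential g"
    and \<epsilon>: "\<epsilon> \<in> {0<..<1}"
    and \<gamma>: "\<gamma> \<in> {0<..<2 * \<beta> * \<epsilon>}"
    and \<alpha>: "\<alpha> = 1 / (2 - \<epsilon>)"
    and lam: "\<And>j. lam j \<in> {0<..1 / \<alpha>}"
    and JA: "JA = resolvent (scale_op \<gamma> A)"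
    and JB: "JB = resolvent (scale_op \<gamma> B)"
    and T: "\<And>y. T y = y - JB y + JA (2 *\<^sub>R JB y - y - \<gamma> *\<^sub>R C (JB y))"
    and zs: "T zs = zs"
    and xs: "xs = JB zs"
    and uBs: "uBs = (1 / \<gamma>) *\<^sub>R (zs - xs)"
    and z: "\<And>k. z (Suc k) = (1 - lam k) *\<^sub>R z k + lam k *\<^sub>R T (z k)"
    and xg: "\<And>k. xg k = JB (z k)"
    and xf: "\<And>k. xf k = JA (2 *\<^sub>R xg k - z k - \<gamma> *\<^sub>R C (xg k))"
    and xf_avg: "\<And>k. xf_avg k = (1 / (\<Sum>i\<le>k. lam i)) *\<^sub>R (\<Sum>i\<le>k. lam i *\<^sub>R xf i)"
    and xg_avg: "\<And>k. xg_avg k = (1 / (\<Sum>i\<le>k. lam i)) *\<^sub>R (\<Sum>i\<le>k. lam i *\<^sub>R xg i)"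
  shows
    "(\<forall>k.
        ereal (- 2 * norm (z 0 - zs) * norm (uBs + C xs) / (\<Sum>i\<le>k. lam i))
          \<le> f (xf_avg k) + g (xg_avg k) + ereal (h (xg_avg k)) - (f xs + g xs + ereal (h xs))
      \<and> f (xf_avg k) + g (xg_avg k) + ereal (h (xg_avg k)) - (f xs + g xs + ereal (h xs))
          \<le> ereal (((norm (z 0 - xs))\<^sup>2 + \<gamma> / (2 * \<beta> * \<epsilon> - \<gamma>) * (norm (z 0 - zs))\<^sup>2
                     + 4 * \<gamma> * norm (z 0 - zs) * norm (C xs))
                   / (2 * \<gamma> * (\<Sum>i\<le>k. lam i))))
   \<and> (\<forall>L. ereal_lipschitz_on L (cball xs ((1 + \<gamma> / \<beta>) * norm (z 0 - zs))) f \<longrightarrow>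
       (\<forall>k.
          0 \<le> f (xg_avg k) + g (xg_avg k) + ereal (h (xg_avg k)) - (f xs + g xs + ereal (h xs))
        \<and> f (xg_avg k) + g (xg_avg k) + ereal (h (xg_avg k)) - (f xs + g xs + ereal (h xs))
            \<le> ereal (((norm (z 0 - xs))\<^sup>2 + \<gamma> / (2 * \<beta> * \<epsilon> - \<gamma>) * (norm (z 0 - zs))\<^sup>2
                       + 4 * \<gamma> * norm (z 0 - zs) * norm (C xs) + 4 * \<gamma> * L * norm (z 0 - zs))
                     / (2 * \<gamma> * (\<Sum>i\<le>k. lam i)))))"
proof -
  define S where "S k = (\<Sum>i\<le>k. lam i)" for k
  define W where "W k = xf k - xg k" for k
  define R where "R = norm (z 0 - zs)"
  define uB where "uB k = (1 / \<gamma>) *\<^sub>R (z k - xg k)" for k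
  define uA where "uA k = (1 / \<gamma>) *\<^sub>R (2 *\<^sub>R xg k - z k - \<gamma> *\<^sub>R C (xg k) - xf k)" for k
  define uAs where "uAs = (1 / \<gamma>) *\<^sub>R (2 *\<^sub>R xs - zs - \<gamma> *\<^sub>R C xs - xs)"
  define F where "F x = real_of_ereal (f x)" for x
  define G where "G x = real_of_ereal (g x)" for x
  have \<gamma>0: "\<gamma> > 0" and \<gamma>1: "2 * \<beta> * \<epsilon> - \<gamma> > 0" and \<epsilon>0: "\<epsilon> > 0" using \<gamma> \<epsilon> by auto
  have lam0: "lam k > 0" and lam1: "lam k \<le> 2 - \<epsilon>" for k using lam[of k] \<alpha> by auto
  have S0: "S k > 0" for k unfolding S_def using lam0 by (intro sum_pos) auto
  have pr_f: "proper_fun f" and cvf: "convex (epi f)" and pr_g: "proper_fun g" and cvg: "convex (epi g)"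
    and cvh: "convex (epi (\<lambda>x. ereal (h x)))"
    using f g h by (auto simp: proper_closed_convex_def)
  note grad_ineq = convex_gradient_inequality[OF cvh grad_h]
  have subB: "uB k \<in> subdifferential g (xg k)" for k
    unfolding uB_def xg JB B by (rule resolvent_subdifferential[OF g \<gamma>0])
  have subA: "uA k \<in> subdifferential f (xf k)" for k
    unfolding uA_def xf JA A by (rule resolvent_subdifferential[OF f \<gamma>0])
  have subBs: "uBs \<in> subdifferential g xs"
    unfolding uBs xs JB B by (rule resolvent_subdifferential[OF g \<gamma>0])
  \<comment> \<open>In \<open>T zs = zs\<close> the vector \<open>zs\<close> cancels, so both
    resolvents return \<open>xs\<close> at the fixed point.\<close>
  have JAs: "JA (2 *\<^sub>R xs - zs - \<gamma> *\<^sub>R C xs) = xs"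
    using zs T[of zs] xs by (simp add: algebra_simps)
  have subAs: "uAs \<in> subdifferential f xs"
    using resolvent_subdifferential[OF f \<gamma>0, of "2 *\<^sub>R xs - zs - \<gamma> *\<^sub>R C xs"] JAs
    by (simp add: uAs_def JA A)
  \<comment> \<open>Optimality of \<open>xs\<close>: the subgradients of \<open>f\<close> and
    \<open>g\<close> and the gradient of \<open>h\<close> sum to zero there.\<close>
  have uAs_eq: "uAs = - (uBs + C xs)"
  proof -
    have eq: "2 *\<^sub>R xs - zs - \<gamma> *\<^sub>R C xs - xs = (xs - zs) - \<gamma> *\<^sub>R C xs" by (simp add: scaleR_2)
    show ?thesis unfolding uAs_def uBs eq using \<gamma>0 by (simp add: scaleR_diff_right)
  qed
  have gB: "\<gamma> *\<^sub>R uB k = z k - xg k" for k using \<gamma>0 by (simp add: uB_def)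
  have gA: "\<gamma> *\<^sub>R uA k = xg k - z k - \<gamma> *\<^sub>R C (xg k) - W k" for k
    using \<gamma>0 by (simp add: uA_def W_def scaleR_2)
  have gBs: "\<gamma> *\<^sub>R uBs = zs - xs" using \<gamma>0 by (simp add: uBs)
  have gAs: "\<gamma> *\<^sub>R uAs = xs - zs - \<gamma> *\<^sub>R C xs" using \<gamma>0 by (simp add: uAs_def scaleR_2)
  have xfW: "xg k + W k = xf k" for k by (simp add: W_def)
  have zstep: "z (Suc k) = z k + lam k *\<^sub>R W k" for k
    unfolding z T W_def xf xg by (simp add: algebra_simps)
  have sumW: "(\<Sum>i\<le>k. lam i *\<^sub>R W i) = z (Suc k) - z 0" for k
    by (induction k) (simp_all add: zstep)

  \<comment> \<open>Fejer monotonicity and summability of the gradient errors\<close>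
  define \<kappa> where "\<kappa> = \<gamma> * (2 * \<beta> * \<epsilon> - \<gamma>) / \<epsilon>"
  have \<kappa>0: "\<kappa> > 0" using \<gamma>0 \<gamma>1 \<epsilon>0 by (simp add: \<kappa>_def)
  define D where "D k = lam k * (norm (C (xg k) - C xs))\<^sup>2" for k
  have D0: "D k \<ge> 0" for k using lam0[of k] by (simp add: D_def)
  have fejer: "(norm (z (Suc k) - zs))\<^sup>2 + \<kappa> * D k \<le> (norm (z k - zs))\<^sup>2" for k
  proof -
    have "(norm (z k + lam k *\<^sub>R W k - zs))\<^sup>2
        + lam k * (\<gamma> * (2 * \<beta> * \<epsilon> - \<gamma>) / \<epsilon>) * (norm (C (xg k) - C xs))\<^sup>2 \<le> (norm (z k - zs))\<^sup>2"
    proof (rule fejer_step[OF gB gA gBs gAs _ _ _ \<gamma>0 \<epsilon>0 less_imp_le[OF lam0] lam1])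
      show "0 \<le> (uA k - uAs) \<bullet> (xg k + W k - xs)"
        unfolding xfW by (rule subdifferential_monotone[OF pr_f subA subAs])
      show "0 \<le> (uB k - uBs) \<bullet> (xg k - xs)"
        by (rule subdifferential_monotone[OF pr_g subB subBs])
      show "\<beta> * (norm (C (xg k) - C xs))\<^sup>2 \<le> (C (xg k) - C xs) \<bullet> (xg k - xs)"
        by (rule baillon_haddad[OF cvh grad_h \<beta> C_lipschitz])
    qed
    then show ?thesis by (simp add: zstep \<kappa>_def D_def mult_ac)
  qed
  \<comment> \<open>Keeping the \<open>D\<close> terms while telescoping yields both the bound
    \<open>zR\<close> on the iterates and the bound on the summed gradient errors.\<close>
  have fejer_sum: "(norm (z (Suc k) - zs))\<^sup>2 + \<kappa> * (\<Sum>i\<le>k. D i) \<le> R\<^sup>2" for k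
  proof (induction k)
    case 0
    show ?case using fejer[of 0] by (simp add: R_def)
  next
    case (Suc k)
    then show ?case using fejer[of "Suc k"] by (simp add: distrib_left)
  qed
  have zR: "norm (z k - zs) \<le> R" for k
  proof (cases k)
    case (Suc j)
    have "0 \<le> \<kappa> * (\<Sum>i\<le>j. D i)" using \<kappa>0 D0 by (simp add: sum_nonneg)
    then have "(norm (z k - zs))\<^sup>2 \<le> R\<^sup>2" using fejer_sum[of j] Suc by simp
    then show ?thesis by (rule power2_le_imp_le) (simp add: R_def)
  qed (simp add: R_def)
  have zdiff: "norm (z (Suc k) - z 0) \<le> 2 * R" for k
    using zR[of "Suc k"] norm_triangle_ineq4[of "z (Suc k) - zs" "z 0 - zs"] by (simp add: R_def)

  \<comment> \<open>Finiteness of the values and distance of the averages\<close>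
  have finf: "\<bar>f (xf k)\<bar> \<noteq> \<infinity>" "\<bar>g (xg k)\<bar> \<noteq> \<infinity>" for k
    by (rule subdifferential_finite[OF pr_f subA] subdifferential_finite[OF pr_g subB])+
  have fins: "\<bar>f xs\<bar> \<noteq> \<infinity>" "\<bar>g xs\<bar> \<noteq> \<infinity>"
    by (rule subdifferential_finite[OF pr_f subAs] subdifferential_finite[OF pr_g subBs])+
  have Jf: "f (xf_avg k) \<le> ereal ((\<Sum>i\<le>k. lam i * F (xf i)) / S k)" for k
    unfolding xf_avg S_def F_def
    by (rule jensen_epi[OF cvf finite_atMost less_imp_le[OF lam0] S0[unfolded S_def] finf(1)])
  have Jg: "g (xg_avg k) \<le> ereal ((\<Sum>i\<le>k. lam i * G (xg i)) / S k)" for k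
    unfolding xg_avg S_def G_def
    by (rule jensen_epi[OF cvg finite_atMost less_imp_le[OF lam0] S0[unfolded S_def] finf(2)])
  have Jh: "h (xg_avg k) \<le> (\<Sum>i\<le>k. lam i * h (xg i)) / S k" for k
    using jensen_epi[OF cvh finite_atMost less_imp_le[OF lam0] S0[unfolded S_def], where x = xg]
    by (simp add: xg_avg S_def)
  have ereal_finite: "\<bar>a\<bar> \<noteq> \<infinity>" if "a \<le> ereal r" "a \<noteq> -\<infinity>" for a r
    using that by (cases a) auto
  have not_minf: "f x \<noteq> -\<infinity>" "g x \<noteq> -\<infinity>" for x
    using pr_f pr_g by (simp_all add: proper_fun_def)
  \<comment> \<open>Jensen excludes plus infinity and properness minus infinity, so the
    \<open>ereal\<close> differences can be computed in the reals.\<close>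
  have finavg: "\<bar>f (xf_avg k)\<bar> \<noteq> \<infinity>" "\<bar>g (xg_avg k)\<bar> \<noteq> \<infinity>" for k
    by (rule ereal_finite[OF Jf not_minf(1)] ereal_finite[OF Jg not_minf(2)])+
  define P where "P = F xs + G xs + h xs"
  define V where "V k = F (xf_avg k) + G (xg_avg k) + h (xg_avg k)" for k
  have real_f: "f x = ereal (F x)" if "\<bar>f x\<bar> \<noteq> \<infinity>" for x using that by (simp add: F_def ereal_real)
  have real_g: "g x = ereal (G x)" if "\<bar>g x\<bar> \<noteq> \<infinity>" for x using that by (simp add: G_def ereal_real)

  \<comment> \<open>Both averages use the same weights, so their gap is a telescoped displacement
    over \<open>S k\<close>. This is the source of the rate in the lower bound.\<close>
  have avg_diff: "xf_avg k - xg_avg k = (1 / S k) *\<^sub>R (z (Suc k) - z 0)" for k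
    unfolding sumW[symmetric] xf_avg xg_avg S_def W_def
    by (simp add: scaleR_diff_right sum_subtractf)
  have avg_dist: "norm (xf_avg k - xg_avg k) \<le> 2 * R / S k" for k
    unfolding avg_diff using zdiff[of k] S0[of k] by (simp add: divide_right_mono)

  \<comment> \<open>Bounds with \<open>f\<close> at one average and \<open>g\<close>,
    \<open>h\<close> at the other\<close>
  define M where "M = (norm (z 0 - xs))\<^sup>2 + \<gamma> / (2 * \<beta> * \<epsilon> - \<gamma>) * R\<^sup>2 + 4 * \<gamma> * R * norm (C xs)"
  have lower: "- 2 * R * norm (uBs + C xs) / S k \<le> V k - P" for k
  proof -
    have "F xs + uAs \<bullet> (xf_avg k - xs) \<le> F (xf_avg k)" "G xs + uBs \<bullet> (xg_avg k - xs) \<le> G (xg_avg k)"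
      unfolding F_def G_def 
      by (rule subgradient_real[OF pr_f subAs finavg(1)] subgradient_real[OF pr_g subBs finavg(2)])+
    then have "uAs \<bullet> (xf_avg k - xs) + uBs \<bullet> (xg_avg k - xs) + C xs \<bullet> (xg_avg k - xs) \<le> V k - P"
      using grad_ineq[of xs "xg_avg k"] by (simp add: V_def P_def)
    \<comment> \<open>By \<open>uAs_eq\<close> the base point \<open>xs\<close> drops out and only
      the gap between the averages is left.\<close>
    moreover have "uAs \<bullet> (xf_avg k - xs) + uBs \<bullet> (xg_avg k - xs) + C xs \<bullet> (xg_avg k - xs)
        = - ((uBs + C xs) \<bullet> (xf_avg k - xg_avg k))"
      unfolding uAs_eq by (simp add: inner_simps)
    moreover have "(uBs + C xs) \<bullet> (xf_avg k - xg_avg k) \<le> norm (uBs + C xs) * (2 * R / S k)"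
      using norm_cauchy_schwarz mult_left_mono[OF avg_dist norm_ge_zero] by (rule order_trans)
    ultimately show ?thesis by (simp add: mult.commute mult.left_commute)
  qed
  have upper: "V k - P \<le> M / (2 * \<gamma> * S k)" for k
  proof -
    define E where "E i = F (xf i) + G (xg i) + h (xg i) - P" for i
    have step: "2 * \<gamma> * (lam i * E i) \<le> (norm (z i - xs))\<^sup>2 - (norm (z (Suc i) - xs))\<^sup>2
        + \<gamma>\<^sup>2 / \<epsilon> * D i - 2 * \<gamma> * (C xs \<bullet> (lam i *\<^sub>R W i))" for i
    proof -
      \<comment> \<open>Subgradients at the iterates, tested at \<open>xs\<close>; the lower bound
        does the reverse.\<close>
      have "F (xf i) + uA i \<bullet> (xs - xf i) \<le> F xs" "G (xg i) + uB i \<bullet> (xs - xg i) \<le> G xs"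
        unfolding F_def G_def 
        by (rule subgradient_real[OF pr_f subA fins(1)] subgradient_real[OF pr_g subB fins(2)])+
      then have "E i \<le> uA i \<bullet> (xf i - xs) + (uB i + C (xg i)) \<bullet> (xg i - xs)"
        using grad_ineq[of "xg i" xs] by (simp add: E_def P_def inner_simps)
      then have "2 * \<gamma> * lam i * E i
          \<le> 2 * \<gamma> * lam i * (uA i \<bullet> (xf i - xs) + (uB i + C (xg i)) \<bullet> (xg i - xs))"
        using \<gamma>0 lam0[of i] by (intro mult_left_mono) auto
      also have "\<dots> \<le> (norm (z i - xs))\<^sup>2 - (norm (z (Suc i) - xs))\<^sup>2
        + \<gamma>\<^sup>2 / \<epsilon> * D i - 2 * \<gamma> * (C xs \<bullet> (lam i *\<^sub>R W i))"
        using upper_step[OF gB[of i] gA[of i] \<epsilon>0 less_imp_le[OF lam0[of i]] lam1, of xs "C xs"]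
        unfolding xfW zstep D_def .
      finally show ?thesis by (simp add: mult.assoc)
    qed
    have sum: "2 * \<gamma> * (\<Sum>i\<le>k. lam i * E i) \<le> (norm (z 0 - xs))\<^sup>2 - (norm (z (Suc k) - xs))\<^sup>2
        + \<gamma>\<^sup>2 / \<epsilon> * (\<Sum>i\<le>k. D i) - 2 * \<gamma> * (C xs \<bullet> (\<Sum>i\<le>k. lam i *\<^sub>R W i))"
    proof (induction k)
      case 0
      show ?case using step[of 0] by simp
    next
      case (Suc k)
      then show ?case using step[of "Suc k"] by (simp add: distrib_left inner_add_right)
    qed
    have "\<kappa> * (\<Sum>i\<le>k. D i) \<le> R\<^sup>2" 
      using fejer_sum[of k] zero_le_power2[of "norm (z (Suc k) - zs)"] by linarith
    then have "(\<Sum>i\<le>k. D i) \<le> R\<^sup>2 / \<kappa>" using \<kappa>0 by (simp add: field_simps)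
    then have "\<gamma>\<^sup>2 / \<epsilon> * (\<Sum>i\<le>k. D i) \<le> \<gamma>\<^sup>2 / \<epsilon> * (R\<^sup>2 / \<kappa>)"
      using \<epsilon>0 by (intro mult_left_mono) auto
    \<comment> \<open>The factor \<open>1 / \<epsilon>\<close> cancels against the one in
      \<open>\<kappa>\<close>, which leaves the constant of the claim.\<close>
    also have "\<dots> = \<gamma> / (2 * \<beta> * \<epsilon> - \<gamma>) * R\<^sup>2"
      using \<epsilon>0 \<gamma>0 by (simp add: \<kappa>_def power2_eq_square)
    finally have D_le: "\<gamma>\<^sup>2 / \<epsilon> * (\<Sum>i\<le>k. D i) \<le> \<gamma> / (2 * \<beta> * \<epsilon> - \<gamma>) * R\<^sup>2" .
    have "- (C xs \<bullet> (z (Suc k) - z 0)) \<le> norm (C xs) * norm (z (Suc k) - z 0)"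
      using Cauchy_Schwarz_ineq2[of "C xs" "z (Suc k) - z 0"] by linarith
    also have "\<dots> \<le> norm (C xs) * (2 * R)" using zdiff by (intro mult_left_mono) auto
    finally have "2 * \<gamma> * - (C xs \<bullet> (z (Suc k) - z 0)) \<le> 2 * \<gamma> * (norm (C xs) * (2 * R))"
      using \<gamma>0 by (intro mult_left_mono) auto
    moreover have "2 * \<gamma> * (norm (C xs) * (2 * R)) = 4 * \<gamma> * R * norm (C xs)" by algebra
    moreover have "2 * \<gamma> * - (C xs \<bullet> (z (Suc k) - z 0)) = - (2 * \<gamma> * (C xs \<bullet> (z (Suc k) - z 0)))"
      by (rule mult_minus_right)
    moreover have "0 \<le> (norm (z (Suc k) - xs))\<^sup>2" by simp
    ultimately have "2 * \<gamma> * (\<Sum>i\<le>k. lam i * E i) \<le> M"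
      using sum D_le unfolding sumW M_def by linarith
    \<comment> \<open>Jensen is used for each function separately, because \<open>f\<close> is
      averaged along \<open>xf\<close> but \<open>g\<close> and \<open>h\<close> along
      \<open>xg\<close>.\<close>
    moreover have "S k * (V k - P) \<le> (\<Sum>i\<le>k. lam i * E i)"
    proof -
      have "F (xf_avg k) \<le> (\<Sum>i\<le>k. lam i * F (xf i)) / S k"
        using Jf[of k] unfolding real_f[OF finavg(1)] by simp
      moreover have "G (xg_avg k) \<le> (\<Sum>i\<le>k. lam i * G (xg i)) / S k"
        using Jg[of k] unfolding real_g[OF finavg(2)] by simp
      ultimately have "V k - P \<le> ((\<Sum>i\<le>k. lam i * F (xf i)) + (\<Sum>i\<le>k. lam i * G (xg i))
          + (\<Sum>i\<le>k. lam i * h (xg i))) / S k - P"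
        using Jh[of k] by (simp add: V_def add_divide_distrib)
      then have "S k * (V k - P) \<le> (\<Sum>i\<le>k. lam i * F (xf i)) + (\<Sum>i\<le>k. lam i * G (xg i))
          + (\<Sum>i\<le>k. lam i * h (xg i)) - S k * P"
        using S0[of k] by (simp add: field_simps)
      also have "\<dots> = (\<Sum>i\<le>k. lam i * E i)"
        by (simp add: E_def S_def sum_distrib_right sum_distrib_left sum.distrib sum_subtractf
            algebra_simps)
      finally show ?thesis .
    qed
    then have "2 * \<gamma> * (S k * (V k - P)) \<le> 2 * \<gamma> * (\<Sum>i\<le>k. lam i * E i)"
      using \<gamma>0 by (intro mult_left_mono) simp_all
    ultimately have "2 * \<gamma> * (S k * (V k - P)) \<le> M" by linarith
    then show ?thesis using \<gamma>0 S0[of k] by (simp add: pos_le_divide_eq mult.commute mult.left_commute)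
  qed

  have part1: "ereal (- 2 * norm (z 0 - zs) * norm (uBs + C xs) / (\<Sum>i\<le>k. lam i))
          \<le> f (xf_avg k) + g (xg_avg k) + ereal (h (xg_avg k)) - (f xs + g xs + ereal (h xs))
      \<and> f (xf_avg k) + g (xg_avg k) + ereal (h (xg_avg k)) - (f xs + g xs + ereal (h xs))
          \<le> ereal (((norm (z 0 - xs))\<^sup>2 + \<gamma> / (2 * \<beta> * \<epsilon> - \<gamma>) * (norm (z 0 - zs))\<^sup>2
                     + 4 * \<gamma> * norm (z 0 - zs) * norm (C xs)) / (2 * \<gamma> * (\<Sum>i\<le>k. lam i)))" for k
    unfolding real_f[OF finavg(1)] real_g[OF finavg(2)] real_f[OF fins(1)] real_g[OF fins(2)]
      plus_ereal.simps ereal_minus(1) ereal_less_eq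
    by (rule conjI[OF lower[of k, unfolded V_def P_def R_def S_def]
          upper[of k, unfolded V_def P_def M_def R_def S_def]])

  \<comment> \<open>All functions at one average, for Lipschitz \<open>f\<close>\<close>
  have part2: "0 \<le> f (xg_avg k) + g (xg_avg k) + ereal (h (xg_avg k)) - (f xs + g xs + ereal (h xs))
        \<and> f (xg_avg k) + g (xg_avg k) + ereal (h (xg_avg k)) - (f xs + g xs + ereal (h xs))
            \<le> ereal (((norm (z 0 - xs))\<^sup>2 + \<gamma> / (2 * \<beta> * \<epsilon> - \<gamma>) * (norm (z 0 - zs))\<^sup>2
                       + 4 * \<gamma> * norm (z 0 - zs) * norm (C xs) + 4 * \<gamma> * L * norm (z 0 - zs))
                     / (2 * \<gamma> * (\<Sum>i\<le>k. lam i)))"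
    if lip: "ereal_lipschitz_on L (cball xs ((1 + \<gamma> / \<beta>) * norm (z 0 - zs))) f" for L k
  proof -
    define \<rho> where "\<rho> = (1 + \<gamma> / \<beta>) * R"
    have R0: "R \<ge> 0" by (simp add: R_def)
    have lipf: "L-lipschitz_on (cball xs \<rho>) F" and finL: "\<And>x. x \<in> cball xs \<rho> \<Longrightarrow> \<bar>f x\<bar> \<noteq> \<infinity>"
      using lip by (auto simp: ereal_lipschitz_on_def \<rho>_def R_def F_def)
    have L0: "L \<ge> 0" by (rule lipschitz_on_nonneg[OF lipf])
    have monB: "0 \<le> ((1 / \<gamma>) *\<^sub>R (z i - xg i) - (1 / \<gamma>) *\<^sub>R (zs - xs)) \<bullet> (xg i - xs)" for i
      using subdifferential_monotone[OF pr_g subB[of i] subBs] unfolding uB_def uBs .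
    have monA: "0 \<le> ((1 / \<gamma>) *\<^sub>R ((2 *\<^sub>R xg i - z i - \<gamma> *\<^sub>R C (xg i)) - xf i)
        - (1 / \<gamma>) *\<^sub>R ((2 *\<^sub>R xs - zs - \<gamma> *\<^sub>R C xs) - xs)) \<bullet> (xf i - xs)" for i
      using subdifferential_monotone[OF pr_f subA[of i] subAs] unfolding uA_def uAs_def .
    have xgR: "norm (xg i - xs) \<le> R" for i
      using resolvent_step_nonexpansive(1)[OF monB \<gamma>0, of i] zR[of i] by simp
    \<comment> \<open>The argument of \<open>JA\<close> moves by at most \<open>R\<close> through
      the reflected resolvent of \<open>g\<close> and by \<open>\<gamma> / \<beta> * R\<close>
      through \<open>C\<close>; the sum is \<open>\<rho>\<close>.\<close>
    have xfR: "norm (xf i - xs) \<le> \<rho>" for i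
    proof -
      have "norm (xf i - xs)
          \<le> norm ((2 *\<^sub>R xg i - z i - \<gamma> *\<^sub>R C (xg i)) - (2 *\<^sub>R xs - zs - \<gamma> *\<^sub>R C xs))"
        by (rule resolvent_step_nonexpansive(1)[OF monA \<gamma>0])
      also have "\<dots> = norm (((2 *\<^sub>R xg i - z i) - (2 *\<^sub>R xs - zs)) - \<gamma> *\<^sub>R (C (xg i) - C xs))"
        by (simp add: algebra_simps)
      also have "\<dots> \<le> norm ((2 *\<^sub>R xg i - z i) - (2 *\<^sub>R xs - zs)) + norm (\<gamma> *\<^sub>R (C (xg i) - C xs))"
        by (rule norm_triangle_ineq4)
      also have "\<dots> \<le> R + \<gamma> * (1 / \<beta> * R)"
      proof (rule add_mono)
        show "norm ((2 *\<^sub>R xg i - z i) - (2 *\<^sub>R xs - zs)) \<le> R"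
          using resolvent_step_nonexpansive(2)[OF monB \<gamma>0, of i] zR[of i] by (rule order_trans)
        have "norm (C (xg i) - C xs) \<le> 1 / \<beta> * norm (xg i - xs)"
          using lipschitz_onD[OF C_lipschitz, of "xg i" xs] by (simp add: dist_norm)
        also have "\<dots> \<le> 1 / \<beta> * R" using xgR \<beta> by (intro mult_left_mono) auto
        finally have "\<gamma> * norm (C (xg i) - C xs) \<le> \<gamma> * (1 / \<beta> * R)"
          using \<gamma>0 by (intro mult_left_mono) auto
        then show "norm (\<gamma> *\<^sub>R (C (xg i) - C xs)) \<le> \<gamma> * (1 / \<beta> * R)"
          using \<gamma>0 by simp
      qed
      finally show ?thesis by (simp add: \<rho>_def algebra_simps)
    qed
    have "R \<le> \<rho>" using R0 \<gamma>0 \<beta> by (simp add: \<rho>_def distrib_right)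
    have mem_f: "xf_avg k \<in> cball xs \<rho>"
      unfolding xf_avg
    proof (rule weighted_mean_in_cball[OF finite_atMost less_imp_le[OF lam0] S0[unfolded S_def]])
      show "xf i \<in> cball xs \<rho>" for i using xfR[of i] by (simp add: dist_norm norm_minus_commute)
    qed
    have mem_g: "xg_avg k \<in> cball xs \<rho>"
      unfolding xg_avg
    proof (rule weighted_mean_in_cball[OF finite_atMost less_imp_le[OF lam0] S0[unfolded S_def]])
      show "xg i \<in> cball xs \<rho>" for i
        using order_trans[OF xgR \<open>R \<le> \<rho>\<close>, of i] by (simp add: dist_norm norm_minus_commute)
    qed
    have fin: "\<bar>f (xg_avg k)\<bar> \<noteq> \<infinity>" using finL[OF mem_g] .
    define V' where "V' = F (xg_avg k) + G (xg_avg k) + h (xg_avg k)"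
    have "F xs + uAs \<bullet> (xg_avg k - xs) \<le> F (xg_avg k)" "G xs + uBs \<bullet> (xg_avg k - xs) \<le> G (xg_avg k)"
      unfolding F_def G_def 
      by (rule subgradient_real[OF pr_f subAs fin] subgradient_real[OF pr_g subBs finavg(2)])+
    then have "uAs \<bullet> (xg_avg k - xs) + uBs \<bullet> (xg_avg k - xs) + C xs \<bullet> (xg_avg k - xs) \<le> V' - P"
      using grad_ineq[of xs "xg_avg k"] by (simp add: V'_def P_def)
    \<comment> \<open>At a common point the linear terms cancel completely, so no error term
      survives.\<close>
    then have low: "0 \<le> V' - P" unfolding uAs_eq by (simp add: inner_simps)
    \<comment> \<open>Moving \<open>f\<close> to the other average costs \<open>L\<close> times the
      gap, which becomes the extra \<open>4 * \<gamma> * L * R\<close> in the numerator.\<close>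
    have "F (xg_avg k) - F (xf_avg k) \<le> L * norm (xf_avg k - xg_avg k)"
      using lipschitz_onD[OF lipf mem_g mem_f] by (simp add: dist_norm norm_minus_commute)
    also have "\<dots> \<le> L * (2 * R / S k)" using avg_dist L0 by (intro mult_left_mono) auto
    finally have "V' - P \<le> M / (2 * \<gamma> * S k) + L * (2 * R / S k)"
      using upper[of k] by (simp add: V'_def V_def)
    also have "\<dots> = (M + 4 * \<gamma> * L * R) / (2 * \<gamma> * S k)"
      using \<gamma>0 S0[of k] by (simp add: add_divide_distrib)
    finally have up: "V' - P \<le> (M + 4 * \<gamma> * L * R) / (2 * \<gamma> * S k)" .
    show ?thesis
      unfolding real_f[OF fin] real_g[OF finavg(2)] real_f[OF fins(1)] real_g[OF fins(2)]
        plus_ereal.simps ereal_minus(1) ereal_less_eq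
      by (rule conjI[OF low[unfolded V'_def P_def] up[unfolded V'_def P_def M_def R_def S_def]])
  qed
  show ?thesis using part1 part2 by blast
qed

end
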